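(* Let $\lambda/\mu$ be a skew Young diagram with exactly one corner, written in the form $$\lambda=(n^m)=(\underbrace{n,\ldots,n}_{m}),\qquad \mu=(\mu_1,\ldots,\mu_m)\quad\text{with }\mu_1=n,\ \mu_m>0 .$$ Let $I$ be the set of $i\in\{1,\ldots,m\}$ such that $\mu[i]:=(\mu_1,\ldots,\mu_i-1,\ldots,\mu_m)$ is non-increasing. Then for all integers $w\ge 1$, $$\sum_{i\in I}\bigl((i-\mu_i)-(m-n)\bigr)\,S_w(\lambda/\mu[i])=(w-|\lambda/\mu|-1)\,S_w(\lambda/\mu).$$
   Context: For partitions $\mu\subset\lambda=(\lambda_1,\dots,\lambda_h)$ (with $\mu_i=0$ beyond the length of $\mu$; zero entries of $\mu$ are allowed), $D(\lambda/\mu)=\{(i,j)\in\mathbb{Z}^2: 1\le i\le h,\ \mu_i<j\le\lambda_i\}$ and $|\lambda/\mu|=|D(\lambda/\mu)|$. A corner is an $(i,j)\in D(\lambda/\mu)$ with $(i,j+1),(i+1,j)\notin D(\lambda/\mu)$. Every skew diagram with exactly one corner can, up to translation, be written in the form $\lambda=(n^m)$, $\mu_1=n$, $\mu_m>0$ (e.g. the one-box diagram is $(2,2)/(2,1)$); for $i\in I$, $D(\lambda/\mu[i])=D(\lambda/\mu)\cup\{(i,\mu_i)\}$ is again a skew Young diagram with one corner. A Young tableau of shape $\lambda/\mu$ is a filling $(k_{i,j})$ of $D(\lambda/\mu)$ by positive integers; its weight is the sum of its entries; it is admissible if $k_{i,j}\ge2$ at every corner; it is semi-standard if $k_{i,j}<k_{i+1,j}$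 and $k_{i,j}\le k_{i,j+1}$ whenever both sides are defined. For an admissible tableau $\boldsymbol{k}=(k_{i,j})$ the Schur multiple zeta value is $\zeta(\boldsymbol{k})=\sum_{(m_{i,j})}\prod_{(i,j)\in D(\lambda/\mu)}m_{i,j}^{-k_{i,j}}$, summed over semi-standard tableaux $(m_{i,j})$ of shape $\lambda/\mu$. $S_w(\lambda/\mu)$ is the sum of $\zeta(\boldsymbol{k})$ over all admissible tableaux $\boldsymbol{k}$ of shape $\lambda/\mu$ and weight $w$ (an empty sum is $0$). *)

theory Defs
  imports "HOL-Analysis.Infinite_Sum" "HOL-Library.FuncSet"
begin

text \<open>Partitions are non-increasing lists of naturals, zero entries allowed. Parts are numbered
  from 1, and are 0 beyond the length of the list.\<close>

definition is_partition :: "nat list \<Rightarrow> bool" where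
  "is_partition \<Lambda> \<longleftrightarrow> sorted_wrt (\<ge>) \<Lambda>"

definition part :: "nat list \<Rightarrow> nat \<Rightarrow> nat" where
  "part \<Lambda> i = (if 1 \<le> i \<and> i \<le> length \<Lambda> then \<Lambda> ! (i - 1) else 0)"

definition skew_shape :: "nat list \<Rightarrow> nat list \<Rightarrow> bool" where
  "skew_shape \<Lambda> \<mu> \<longleftrightarrow> is_partition \<Lambda> \<and> is_partition \<mu> \<and> (\<forall>i\<ge>1. part \<mu> i \<le> part \<Lambda> i)"

text \<open>Boxes are pairs (row, column), both counted from 1, so naturals suffice as coordinates.\<close>

definition diagram :: "nat list \<Rightarrow> nat list \<Rightarrow> (nat \<times> nat) set" where
  "diagram \<Lambda> \<mu> = {(i, j). 1 \<le> i \<and> i \<le> length \<Lambda> \<and> part \<mu> i < j \<and> j \<le> part \<Lambda> i}"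

text \<open>The list \<open>\<mu>[i]\<close>, with the \<open>i\<close>-th part lowered by one. The subtraction is truncated, so this
  is meant for \<open>part \<mu> i > 0\<close> only.\<close>

definition lower_part :: "nat list \<Rightarrow> nat \<Rightarrow> nat list" where
  "lower_part \<mu> i = \<mu>[i - 1 := part \<mu> i - 1]"

definition corners :: "(nat \<times> nat) set \<Rightarrow> (nat \<times> nat) set" where
  "corners D = {(i, j). (i, j) \<in> D \<and> (i, j + 1) \<notin> D \<and> (i + 1, j) \<notin> D}"

text \<open>Fillings are extensional functions on the diagram, so that distinct functions are distinct
  tableaux.\<close>

definition tableaux :: "(nat \<times> nat) set \<Rightarrow> (nat \<times> nat \<Rightarrow> nat) set" where
  "tableaux D = D \<rightarrow>\<^sub>E {1..}"

definition weight :: "(nat \<times> nat) set \<Rightarrow> (nat \<times> nat \<Rightarrow> nat) \<Rightarrow> nat" where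
  "weight D k = (\<Sum>p\<in>D. k p)"

definition admissible :: "(nat \<times> nat) set \<Rightarrow> (nat \<times> nat \<Rightarrow> nat) \<Rightarrow> bool" where
  "admissible D k \<longleftrightarrow> (\<forall>p\<in>corners D. k p \<ge> 2)"

definition semistandard :: "(nat \<times> nat) set \<Rightarrow> (nat \<times> nat \<Rightarrow> nat) \<Rightarrow> bool" where
  "semistandard D k \<longleftrightarrow>
     (\<forall>i j. (i, j) \<in> D \<and> (i + 1, j) \<in> D \<longrightarrow> k (i, j) < k (i + 1, j)) \<and>
     (\<forall>i j. (i, j) \<in> D \<and> (i, j + 1) \<in> D \<longrightarrow> k (i, j) \<le> k (i, j + 1))"

definition schur_zeta :: "(nat \<times> nat) set \<Rightarrow> (nat \<times> nat \<Rightarrow> nat) \<Rightarrow> real" where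
  "schur_zeta D k =
     (\<Sum>\<^sub>\<infinity>m\<in>{m \<in> tableaux D. semistandard D m}. \<Prod>p\<in>D. 1 / real (m p) ^ k p)"

definition schur_zeta_sum :: "nat \<Rightarrow> (nat \<times> nat) set \<Rightarrow> real" where
  "schur_zeta_sum w D =
     (\<Sum>k\<in>{k \<in> tableaux D. admissible D k \<and> weight D k = w}. schur_zeta D k)"

end

theory Submission
  imports Defs "HOL-Computational_Algebra.Formal_Power_Series" "HOL-Analysis.Summation_Tests"
begin

text \<open>With \<open>y\<^sub>a = 1 / (a - X)\<close>, the sum of \<open>\<Prod> T(p) ^ (- k(p))\<close> over all admissible \<open>k\<close> of weight \<open>w\<close> is,
  for a fixed semistandard \<open>T\<close> with corner entry \<open>N\<close>, the coefficient of \<open>X ^ (w - |D| - 1)\<close> in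
  \<open>\<Prod> y\<^bsub>T(p)\<^esub> / N\<close>. Since \<open>y\<^sub>a' = y\<^sub>a\<^sup>2\<close>, the factor \<open>w - |D| - 1\<close> is produced by differentiation, and the theorem
  follows, already for each \<open>N\<close>, from an identity for the Schur polynomials \<open>s\<^sub>D = \<Sum> \<Prod> y\<^bsub>T(p)\<^esub>\<close> in
  \<open>y\<^sub>1, \<dots>, y\<^sub>N\<close>: the derivation \<open>\<Sum> y\<^sub>a\<^sup>2 \<partial>/\<partial>y\<^sub>a\<close> maps \<open>s\<^sub>D\<close> to the sum of \<open>c(b) s\<^bsub>D \<union> {b}\<^esub>\<close> over the addable
  boxes \<open>b\<close>, where \<open>c(b)\<close> is the content counted from the corner. That identity is proved by induction
  on the number of variables, removing the horizontal strip of smallest entries.\<close>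

section \<open>Inner shapes, horizontal strips and the Schur polynomial as a strip recursion\<close>

text \<open>The outer shape stays the \<open>m\<close> by \<open>n\<close> rectangle throughout, so
  a diagram is given by its inner shape alone. That shape is a function rather than a list so that
  lowering a part is a function update.\<close>

definition rows :: "nat \<Rightarrow> nat \<Rightarrow> (nat \<Rightarrow> nat) \<Rightarrow> (nat \<times> nat) set" where
  "rows m n f = (SIGMA i:{1..m}. {f i<..n})"

definition inner_shape :: "nat \<Rightarrow> nat \<Rightarrow> (nat \<Rightarrow> nat) \<Rightarrow> bool" where
  "inner_shape m n f \<longleftrightarrow> (\<forall>i\<in>{1..m}. f i \<le> n) \<and> (\<forall>i\<in>{1..m}. \<forall>j\<in>{1..m}. i \<le> j \<longrightarrow> f j \<le> f i)"

text \<open>Row \<open>0\<close> is taken to have length \<open>n\<close>, so that \<open>strips m n f\<close> consists of the inner shapes \<open>g\<close>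
  for which \<open>g/f\<close> is a horizontal strip.\<close>

definition upper :: "nat \<Rightarrow> (nat \<Rightarrow> nat) \<Rightarrow> nat \<Rightarrow> nat" where
  "upper n f i = (if i = 1 then n else f (i - 1))"

definition strips :: "nat \<Rightarrow> nat \<Rightarrow> (nat \<Rightarrow> nat) \<Rightarrow> (nat \<Rightarrow> nat) set" where
  "strips m n f = (\<Pi>\<^sub>E i\<in>{1..m}. {f i..upper n f i})"

text \<open>The branching rule of skew Schur polynomials: each variable fills one horizontal strip.
  Without variables only the empty diagram counts. No monotonicity of \<open>f\<close> is demanded,
  so that every \<open>f(i := f i - 1)\<close> is a legal argument.\<close>

fun strip_sum :: "nat \<Rightarrow> nat \<Rightarrow> 'a::comm_ring_1 list \<Rightarrow> (nat \<Rightarrow> nat) \<Rightarrow> 'a" where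
  "strip_sum m n [] f = (if \<forall>i\<in>{1..m}. f i = n then 1 else 0)"
| "strip_sum m n (y # ys) f =
     (\<Sum>g\<in>strips m n f. y ^ (sum g {1..m} - sum f {1..m}) * strip_sum m n ys g)"

text \<open>An ascent leaves no value for row \<open>Suc i\<close>, which would have to lie between
  \<open>f (Suc i)\<close> and \<open>f i\<close>; without variables it contradicts
  \<open>f i = n\<close>. Sums over all rows thereby need no test that the lowered shape is still a
  partition.\<close>

lemma strip_sum_ascent:
  assumes "i \<in> {1..m}" "Suc i \<in> {1..m}" "f i < f (Suc i)" "\<forall>i\<in>{1..m}. f i \<le> n"
  shows "strip_sum m n ys f = 0"
proof (cases ys)
  case Nil
  have "f i \<noteq> n" using assms by fastforce
  with Nil assms show ?thesis by auto
next
  case (Cons y zs)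
  have "{f (Suc i)..upper n f (Suc i)} = {}" using assms by (auto simp: upper_def)
  then have "strips m n f = {}"
    unfolding strips_def using assms(2) by (subst PiE_eq_empty_iff) blast
  with Cons show ?thesis by simp
qed

lemma inner_shape_le: "inner_shape m n f \<Longrightarrow> 1 \<le> i \<Longrightarrow> i \<le> m \<Longrightarrow> f i \<le> n"
  by (simp add: inner_shape_def)

lemma inner_shape_antimono:
  "inner_shape m n f \<Longrightarrow> 1 \<le> i \<Longrightarrow> i \<le> j \<Longrightarrow> j \<le> m \<Longrightarrow> f j \<le> f i"
  by (simp add: inner_shape_def)

lemma upper_le: "inner_shape m n f \<Longrightarrow> i \<in> {1..m} \<Longrightarrow> upper n f i \<le> n"
  using inner_shape_le[of m n f "i - 1"] by (auto simp: upper_def)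

lemma finite_strips: "finite (strips m n f)"
  by (auto simp: strips_def intro!: finite_PiE)

lemma mem_strips:
  assumes "g \<in> strips m n f" "i \<in> {1..m}"
  shows "f i \<le> g i" "g i \<le> upper n f i"
  using assms by (auto simp: strips_def PiE_def Pi_def)

lemma inner_shape_strips:
  assumes g: "g \<in> strips m n f" and f: "inner_shape m n f"
  shows "inner_shape m n g"
proof -
  have "g j \<le> g i" if "i \<in> {1..m}" "j \<in> {1..m}" "i < j" for i j
  proof -
    have "g j \<le> f (j - 1)" using mem_strips(2)[OF g, of j] that by (auto simp: upper_def)
    also have "\<dots> \<le> f i" using inner_shape_antimono[OF f, of i "j - 1"] that by auto
    also have "\<dots> \<le> g i" using mem_strips(1)[OF g] that by auto
    finally show ?thesis .
  qed
  then show ?thesis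
    unfolding inner_shape_def using mem_strips(2)[OF g] upper_le[OF f]
    by (metis le_trans nat_less_le order_refl)
qed

section \<open>The derivation formula for strip sums\<close>

text \<open>In the induction step of the derivation formula, both sides are linear combinations of the
  \<open>strip_sum m n ys h\<close>, and their coefficients agree unless \<open>h\<close> has an ascent, where \<open>strip_sum\<close>
  vanishes.\<close>

lemma strip_coefficient:
  fixes ys :: "'a::comm_ring_1 list"
  assumes f: "inner_shape m n f" "f 1 = n" "f m \<ge> 1" "m \<ge> 1"
    and h: "h \<in> (\<Pi>\<^sub>E i\<in>{1..m}. {..n})"
  shows "of_int ((\<Sum>i=1..m. if h(i := h i + 1) \<in> strips m n f
              then int i - int (h i + 1) - (int m - int n) else 0)
          + (if h \<in> strips m n f then int (sum h {1..m}) - int (sum f {1..m}) else 0))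
           * strip_sum m n ys h
       = of_int (\<Sum>i=1..m. if h \<in> strips m n (f(i := f i - 1))
              then int i - int (f i) - (int m - int n) else 0) * strip_sum m n ys h"
proof (cases "\<exists>i\<in>{1..m}. Suc i \<in> {1..m} \<and> h i < h (Suc i)")
  case True
  then have "strip_sum m n ys h = 0" 
    using strip_sum_ascent[of _ m h n ys] h by (auto simp: PiE_def Pi_def)
  then show ?thesis by simp
next
  case desc: False
  have hE: "h \<in> extensional {1..m}" using h by (auto simp: PiE_def)
  have fpos: "f i \<ge> 1" if "i \<in> {1..m}" for i
    using f that by (auto simp: inner_shape_def intro: order_trans)
  have fdesc: "f i \<le> f (i - 1)" if "i \<in> {2..m}" for i
    using inner_shape_antimono[OF f(1), of "i - 1" i] that by auto
  have fn: "f i \<le> n" if "i \<in> {1..m}" for i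
    using f(1) that by (auto simp: inner_shape_def)
  have mem: "g \<in> strips m n f' \<longleftrightarrow> (\<forall>i\<in>{1..m}. f' i \<le> g i \<and> g i \<le> upper n f' i)"
    if "g \<in> extensional {1..m}" for g f' using that by (auto simp: strips_def PiE_def Pi_def)
  have mem1: "h(i := h i + 1) \<in> strips m n f \<longleftrightarrow>
      (f i \<le> h i + 1 \<and> h i + 1 \<le> upper n f i \<and> 
      (\<forall>j\<in>{1..m}. j \<noteq> i \<longrightarrow> f j \<le> h j \<and> h j \<le> upper n f j))"
    if "i \<in> {1..m}" for i
    using that hE by (subst mem) (auto simp: extensional_def)
  \<comment> \<open>Lowering \<open>f i\<close> relaxes the lower bound of row \<open>i\<close>, but
    it also lowers the upper bound of row \<open>Suc i\<close>, if there is such a row.\<close>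
  have mem2: "h \<in> strips m n (f(i := f i - 1)) \<longleftrightarrow>
     (f i \<le> h i + 1 \<and> h i \<le> upper n f i \<and> (i < m \<longrightarrow> h (Suc i) + 1 \<le> f i) \<and>
      (\<forall>j\<in>{1..m}. j \<noteq> i \<longrightarrow> f j \<le> h j \<and> h j \<le> upper n f j))" (is "_ \<longleftrightarrow> ?R")
    if i: "i \<in> {1..m}" for i
  proof
    assume L: "h \<in> strips m n (f(i := f i - 1))"
    have L: "(f(i := f i - 1)) j \<le> h j \<and> h j \<le> upper n (f(i := f i - 1)) j" if "j \<in> {1..m}" for j
      using L hE that by (auto simp: mem)
    have up: "upper n (f(i := f i - 1)) j \<le> upper n f j" for j by (auto simp: upper_def)
    have "h (Suc i) + 1 \<le> f i" if "i < m"
      using L[of "Suc i"] that i fpos[OF i] by (auto simp: upper_def)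
    moreover have "h i \<le> upper n f i" "f i \<le> h i + 1" using L[OF i] up[of i] by auto
    moreover have "f j \<le> h j \<and> h j \<le> upper n f j" if "j \<in> {1..m}" "j \<noteq> i" for j
      using L[OF that(1)] up[of j] that by auto
    ultimately show ?R by blast
  next
    assume R: ?R
    show "h \<in> strips m n (f(i := f i - 1))"
      unfolding mem[OF hE]
    proof
      fix j assume j: "j \<in> {1..m}"
      consider "j = i" | "j = Suc i" | "j \<noteq> i" "j \<noteq> Suc i" by blast
      then show "(f(i := f i - 1)) j \<le> h j \<and> h j \<le> upper n (f(i := f i - 1)) j"
      proof cases
        case 1 then show ?thesis using R i by (auto simp: upper_def)
      next
        case 2 then show ?thesis using R i j by (auto simp: upper_def)
      next
        case 3 then show ?thesis using R j by (auto simp: upper_def split: if_splits)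
      qed
    qed
  qed
  show ?thesis
  proof (cases "h \<in> strips m n f")
    case True
    then have hb: "f j \<le> h j" "h j \<le> upper n f j" if "j \<in> {1..m}" for j
      using that hE by (auto simp: mem)
    \<comment> \<open>As \<open>f 1 = n\<close>, row 1 is full and cannot be raised, so the first
      sum will start at \<open>i = 2\<close>.\<close>
    have h1: "h 1 = n" using hb[of 1] f by (auto simp: upper_def)
    have m1: "{1..m} = insert 1 {2..m}" "1 \<notin> {2..m}" using f(4) by auto
    have m2: "{1..m} = insert m {1..<m}" using f(4) by auto
    let ?K = "int n - int m"
    have t1: "h(i := h i + 1) \<in> strips m n f \<longleftrightarrow> h i < upper n f i" if "i \<in> {1..m}" for i
      unfolding mem1[OF that] using hb hb(1)[OF that] by (auto simp: less_eq_Suc_le)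
    have t2: "h \<in> strips m n (f(i := f i - 1)) \<longleftrightarrow> (i < m \<longrightarrow> h (Suc i) < f i)"
      if "i \<in> {1..m}" for i
      unfolding mem2[OF that] using hb hb[OF that] by (auto simp: less_eq_Suc_le)
    have "(\<Sum>i=1..m. if h(i := h i + 1) \<in> strips m n f
              then int i - int (h i + 1) - (int m - int n) else 0)
        = (\<Sum>i=1..m. if h i < upper n f i then int i - 1 - int (h i) + ?K else 0)"
      by (intro sum.cong refl) (simp only: t1, simp)
    also have "\<dots> = (\<Sum>i=2..m. if h i < f (i - 1) then int i - 1 - int (h i) + ?K else 0)"
      unfolding m1 by (subst sum.insert) (use h1 in \<open>auto simp: upper_def intro!: sum.cong\<close>)
    finally have L: "(\<Sum>i=1..m. if h(i := h i + 1) \<in> strips m n f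
              then int i - int (h i + 1) - (int m - int n) else 0)
        = (\<Sum>i=2..m. if h i < f (i - 1) then int i - 1 - int (h i) + ?K else 0)" .
    have "(\<Sum>i=1..m. if h \<in> strips m n (f(i := f i - 1))
              then int i - int (f i) - (int m - int n) else 0)
        = (\<Sum>i=1..m. if i < m \<longrightarrow> h (Suc i) < f i then int i - int (f i) + ?K else 0)"
      by (intro sum.cong refl) (simp only: t2, simp)
    \<comment> \<open>Row \<open>m\<close> has no row below it, so its term is unconditional.
      Shifting the other rows by one produces the condition of the first sum.\<close>
    also have "\<dots> = (int m - int (f m) + ?K)
         + (\<Sum>i\<in>{1..<m}. if h (Suc i) < f i then int i - int (f i) + ?K else 0)"
      unfolding m2 by (subst sum.insert) (auto intro!: sum.cong)
    also have "(\<Sum>i\<in>{1..<m}. if h (Suc i) < f i then int i - int (f i) + ?K else 0)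
       = (\<Sum>i=2..m. if h i < f (i - 1) then int i - 1 - int (f (i - 1)) + ?K else 0)"
      by (rule sum.reindex_bij_witness[of _ "\<lambda>i. i - 1" Suc]) auto
    finally have R: "(\<Sum>i=1..m. if h \<in> strips m n (f(i := f i - 1))
              then int i - int (f i) - (int m - int n) else 0) = (int m - int (f m) + ?K)
         + (\<Sum>i=2..m. if h i < f (i - 1) then int i - 1 - int (f (i - 1)) + ?K else 0)" .
    \<comment> \<open>Where the condition fails, \<open>h i = f (i - 1)\<close>, so each difference
      is \<open>f (i - 1) - h i\<close>. Added to the difference of the sizes of \<open>h\<close>
      and \<open>f\<close>, the total is \<open>n - f m\<close>, which is the term of row
      \<open>m\<close>.\<close>
    have "(\<Sum>i=2..m. if h i < f (i - 1) then int i - 1 - int (h i) + ?K else 0)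
        - (\<Sum>i=2..m. if h i < f (i - 1) then int i - 1 - int (f (i - 1)) + ?K else 0)
        = (\<Sum>i=2..m. int (f (i - 1)) - int (h i))"
      unfolding sum_subtractf[symmetric]
    proof (intro sum.cong refl)
      fix x assume "x \<in> {2..m}"
      then have "h x \<le> f (x - 1)" using hb(2)[of x] by (auto simp: upper_def)
      then show "(if h x < f (x - 1) then int x - 1 - int (h x) + ?K else 0) -
           (if h x < f (x - 1) then int x - 1 - int (f (x - 1)) + ?K else 0) =
            int (f (x - 1)) - int (h x)"
        by (cases "h x < f (x - 1)") simp_all
    qed
    also have "\<dots> = (\<Sum>i=2..m. int (f (i - 1))) - (\<Sum>i=2..m. int (h i))"
      by (simp add: sum_subtractf)
    also have "(\<Sum>i=2..m. int (f (i - 1))) = (\<Sum>i\<in>{1..<m}. int (f i))"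
      by (rule sum.reindex_bij_witness[of _ Suc "\<lambda>i. i - 1"]) auto
    also have "\<dots> = int (sum f {1..m}) - int (f m)" unfolding m2 by simp
    also have "(\<Sum>i=2..m. int (h i)) = int (sum h {1..m}) - int n"
      unfolding m1 using h1 by simp
    finally have "(\<Sum>i=2..m. if h i < f (i - 1) then int i - 1 - int (h i) + ?K else 0)
          + (int (sum h {1..m}) - int (sum f {1..m})) = (int m - int (f m) + ?K)
         + (\<Sum>i=2..m. if h i < f (i - 1) then int i - 1 - int (f (i - 1)) + ?K else 0)"
      by linarith
    then show ?thesis unfolding L R by (simp only: True if_True)
  next
    case False
    \<comment> \<open>Now the terms agree row by row: either condition forces
      \<open>f i = h i + 1\<close>, so both describe the same box.\<close>
    have "(if h(i := h i + 1) \<in> strips m n f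
              then int i - int (h i + 1) - (int m - int n) else 0)
        = (if h \<in> strips m n (f(i := f i - 1))
              then int i - int (f i) - (int m - int n) else 0)" if i: "i \<in> {1..m}" for i
    proof -
      \<comment> \<open>The other rows are in range and \<open>h\<close> is no strip, so row
        \<open>i\<close> must miss its lower bound, by exactly one.\<close>
      have eq: "f i = h i + 1" if "f i \<le> h i + 1" "h i \<le> upper n f i"
          "\<forall>j\<in>{1..m}. j \<noteq> i \<longrightarrow> f j \<le> h j \<and> h j \<le> upper n f j"
      proof (rule ccontr)
        assume "f i \<noteq> h i + 1"
        then have "h \<in> strips m n f" using that unfolding mem[OF hE] 
          by (metis Suc_eq_plus1 le_SucE)
        with False show False ..
      qed
      \<comment> \<open>For \<open>f i = h i + 1\<close> the remaining inequalities are automatic,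
        because \<open>f\<close> is non-increasing and \<open>h\<close> has no ascent.\<close>
      have fu: "f i \<le> upper n f i" using fdesc[of i] fn[OF i] i by (auto simp: upper_def)
      have hs: "h (Suc i) \<le> h i" if "i < m" using desc i that by force
      let ?Q = "\<forall>j\<in>{1..m}. j \<noteq> i \<longrightarrow> f j \<le> h j \<and> h j \<le> upper n f j"
      show ?thesis
      proof (cases "f i = h i + 1 \<and> ?Q")
        case True
        then have "h i + 1 \<le> upper n f i" "i < m \<longrightarrow> h (Suc i) + 1 \<le> f i" using fu hs by auto
        with True show ?thesis unfolding mem1[OF i] mem2[OF i] by auto
      next
        case False
        then have "\<not> (f i \<le> h i + 1 \<and> h i \<le> upper n f i \<and> ?Q)" using eq by blast
        then show ?thesis unfolding mem1[OF i] mem2[OF i] by auto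
      qed
    qed
    then show ?thesis using False by simp
  qed
qed

text \<open>The coefficient of row \<open>i\<close> is the content of the added box minus that of
  the corner \<open>(m, n)\<close>. By the product rule, a strip \<open>g\<close> gives one term
  from the power of \<open>y\<close> and, by induction, terms with one part of \<open>g\<close>
  lowered; the induction hypothesis applies since \<open>g 1 = n\<close> and
  \<open>g m \<ge> f m\<close>. The terms are then collected by the polynomial that remains.\<close>

lemma deriv_strip_sum:
  fixes ys :: "'a::comm_ring_1 fps list"
  assumes "inner_shape m n f" "f 1 = n" "f m \<ge> 1" "m \<ge> 1"
    and ys: "\<forall>y\<in>set ys. fps_deriv y = y ^ 2"
  shows "fps_deriv (strip_sum m n ys f) =
    (\<Sum>i=1..m. of_int (int i - int (f i) - (int m - int n)) * strip_sum m n ys (f(i := f i - 1)))"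
  using assms
proof (induction ys arbitrary: f)
  case Nil
  \<comment> \<open>Since \<open>1 \<le> f i \<le> n\<close>, a lowered part is never
    \<open>n\<close>, so the right side is 0, as is the derivative of a constant.\<close>
  have "f i - 1 \<noteq> n" if "i \<in> {1..m}" for i
  proof -
    have "f m \<le> f i" "f i \<le> n" using Nil that by (auto simp: inner_shape_def)
    then show ?thesis using Nil by auto
  qed
  then have "strip_sum m n ([] :: 'a fps list) (f(i := f i - 1)) = 0" if "i \<in> {1..m}" for i
    using that by auto
  then show ?case by simp
next
  case (Cons y ys)
  note f = Cons.prems(1-4)
  let ?s = "\<lambda>g. sum g {1..m}"
  \<comment> \<open>All sums get extended to this one finite set, with indicator coefficients, so
    that they can be compared termwise.\<close>
  let ?B = "\<Pi>\<^sub>E i\<in>{1..m}. {..n}"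
  let ?S = "strip_sum m n ys"
  let ?c = "\<lambda>f i. int i - int (f i) - (int m - int n)"
  \<comment> \<open>The power common to all terms: its extra factor \<open>y\<close> comes from
    differentiating \<open>y\<close>, from \<open>h\<close> having one less than \<open>g\<close>,
    or from lowering a part of \<open>f\<close>.\<close>
  let ?E = "\<lambda>h. y ^ (Suc (?s h) - ?s f)"
  have fin: "finite ?B" by (intro finite_PiE) auto
  have upn: "upper n f i \<le> n" if "i \<in> {1..m}" for i
    using f(1) that by (rule upper_le)
  have fpos: "f i \<ge> 1" if "i \<in> {1..m}" for i
    using f that by (auto simp: inner_shape_def intro: order_trans)
  have sB: "strips m n f \<subseteq> ?B" 
    unfolding strips_def by (intro PiE_mono) (use upn in auto)
  have sB': "strips m n (f(i := f i - 1)) \<subseteq> ?B" if "i \<in> {1..m}" for i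
  proof -
    have "upper n (f(i := f i - 1)) j \<le> upper n f j" for j by (auto simp: upper_def)
    then show ?thesis unfolding strips_def
      by (intro PiE_mono) (use upn in \<open>auto intro: order_trans\<close>)
  qed
  have sle: "?s f \<le> ?s g" if "g \<in> strips m n f" for g
    using that by (intro sum_mono) (auto simp: strips_def PiE_def Pi_def)
  have s1: "?s (g(i := g i + 1)) = Suc (?s g)" if "i \<in> {1..m}" for g i
  proof -
    have "?s (g(i := g i + 1)) = (\<Sum>j\<in>{1..m}. g j + (if j = i then 1 else 0))"
      by (intro sum.cong) auto
    then show ?thesis using that by (simp add: sum.distrib)
  qed
  have s2: "?s f = Suc (?s (f(i := f i - 1)))" if "i \<in> {1..m}" for i
    using s1[OF that, of "f(i := f i - 1)"] fpos[OF that] by simp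
  have y: "fps_deriv y = y ^ 2" using Cons.prems by simp
  have "fps_deriv (strip_sum m n (y # ys) f) =
     (\<Sum>g\<in>strips m n f. of_nat (?s g - ?s f) * y ^ Suc (?s g - ?s f) * ?S g
        + y ^ (?s g - ?s f) * fps_deriv (?S g))"
    unfolding strip_sum.simps fps_deriv_sum
  proof (intro sum.cong refl)
    fix g
    have pw: "fps_deriv (y ^ k) = of_nat k * y ^ Suc k" for k
      by (induction k) (simp_all add: y power2_eq_square algebra_simps)
    show "fps_deriv (y ^ (?s g - ?s f) * ?S g) = of_nat (?s g - ?s f) * y ^ Suc (?s g - ?s f) * ?S g
        + y ^ (?s g - ?s f) * fps_deriv (?S g)"
      unfolding fps_deriv_mult pw by (simp add: algebra_simps)
  qed
  also have "\<dots> = (\<Sum>g\<in>strips m n f. of_nat (?s g - ?s f) * ?E g * ?S g)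
     + (\<Sum>i=1..m. \<Sum>g\<in>strips m n f. of_int (?c g i) * y ^ (?s g - ?s f) * ?S (g(i := g i - 1)))"
    (is "_ = ?X + ?Y")
  proof -
    have "fps_deriv (?S g) = (\<Sum>i=1..m. of_int (?c g i) * ?S (g(i := g i - 1)))"
      if "g \<in> strips m n f" for g
      using inner_shape_strips[OF that f(1)] mem_strips[OF that, of 1] mem_strips(1)[OF that, of m]
        Cons.prems by (intro Cons.IH) (auto simp: upper_def)
    moreover have "y ^ Suc (?s g - ?s f) = ?E g" if "g \<in> strips m n f" for g
      using sle[OF that] by (simp only: Suc_diff_le)
    ultimately have "(\<Sum>g\<in>strips m n f. of_nat (?s g - ?s f) * y ^ Suc (?s g - ?s f) * ?S g
        + y ^ (?s g - ?s f) * fps_deriv (?S g))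
      = (\<Sum>g\<in>strips m n f. of_nat (?s g - ?s f) * ?E g * ?S g
        + (\<Sum>i=1..m. of_int (?c g i) * y ^ (?s g - ?s f) * ?S (g(i := g i - 1))))"
      by (intro sum.cong refl) (simp only: sum_distrib_left mult_ac)
    also have "\<dots> = ?X + ?Y"
      unfolding sum.distrib by (subst (2) sum.swap) (rule refl)
    finally show ?thesis .
  qed
  also have "?X = (\<Sum>h\<in>?B. of_int (if h \<in> strips m n f then int (?s h) - int (?s f) else 0) * ?E h * ?S h)"
    using fin sB sle by (intro sum.mono_neutral_cong_left) (auto simp: of_nat_diff)
  also have "?Y = (\<Sum>i=1..m. \<Sum>h\<in>?B. of_int (if h(i := h i + 1) \<in> strips m n f
              then int i - int (h i + 1) - (int m - int n) else 0) * ?E h * ?S h)"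
  proof (rule sum.cong[OF refl])
    fix i assume i: "i \<in> {1..m}"
    \<comment> \<open>Collect by the lowered shape \<open>h\<close>. Raising undoes the truncated
      subtraction because \<open>1 \<le> f i \<le> g i\<close>.\<close>
    have "(\<Sum>g\<in>strips m n f. of_int (?c g i) * y ^ (?s g - ?s f) * ?S (g(i := g i - 1))) =
      (\<Sum>h\<in>{h\<in>?B. h(i := h i + 1) \<in> strips m n f}. of_int (int i - int (h i + 1) - (int m - int n)) * ?E h * ?S h)"
    proof (rule sum.reindex_bij_witness[of _ "\<lambda>h. h(i := h i + 1)" "\<lambda>g. g(i := g i - 1)"])
      fix g assume g: "g \<in> strips m n f"
      have "f i \<le> g i" using g i by (auto simp: strips_def PiE_def Pi_def)
      then have gi: "g i \<ge> 1" using fpos[OF i] by simp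
      then show eq: "(g(i := g i - 1))(i := (g(i := g i - 1)) i + 1) = g" by auto
      have "g \<in> ?B" using g sB by blast
      then have "g(i := g i - 1) \<in> ?B" using i by (fastforce simp: PiE_def Pi_def extensional_def)
      then show "g(i := g i - 1) \<in> {h\<in>?B. h(i := h i + 1) \<in> strips m n f}" using eq g by simp
      have "Suc (?s (g(i := g i - 1))) = ?s g" using s1[OF i, of "g(i := g i - 1)"] by (simp only: eq)
      then show "of_int (int i - int ((g(i := g i - 1)) i + 1) - (int m - int n)) * ?E (g(i := g i - 1)) * ?S (g(i := g i - 1))
        = of_int (?c g i) * y ^ (?s g - ?s f) * ?S (g(i := g i - 1))"
        using gi by (simp add: of_nat_diff)
    qed auto
    also have "\<dots> = (\<Sum>h\<in>?B. of_int (if h(i := h i + 1) \<in> strips m n f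
              then int i - int (h i + 1) - (int m - int n) else 0) * ?E h * ?S h)"
      using fin by (intro sum.mono_neutral_cong_left) auto
    finally show "(\<Sum>g\<in>strips m n f. of_int (?c g i) * y ^ (?s g - ?s f) * ?S (g(i := g i - 1))) =
      (\<Sum>h\<in>?B. of_int (if h(i := h i + 1) \<in> strips m n f
              then int i - int (h i + 1) - (int m - int n) else 0) * ?E h * ?S h)" .
  qed
  also have "(\<Sum>h\<in>?B. of_int (if h \<in> strips m n f then int (?s h) - int (?s f) else 0) * ?E h * ?S h) + \<dots>
    = (\<Sum>h\<in>?B. ?E h * (of_int ((\<Sum>i=1..m. if h(i := h i + 1) \<in> strips m n f
              then int i - int (h i + 1) - (int m - int n) else 0)
          + (if h \<in> strips m n f then int (?s h) - int (?s f) else 0)) * ?S h))"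
    by (subst sum.swap)
      (simp only: sum.distrib[symmetric] of_int_add of_int_sum sum_distrib_left sum_distrib_right
        distrib_left distrib_right mult_ac add_ac)
  also have "\<dots> = (\<Sum>h\<in>?B. ?E h * (of_int (\<Sum>i=1..m. if h \<in> strips m n (f(i := f i - 1))
              then ?c f i else 0) * ?S h))"
    by (rule sum.cong[OF refl], rule arg_cong2[where f = "(*)", OF refl], erule strip_coefficient[OF f])
  also have "\<dots> = (\<Sum>i=1..m. \<Sum>h\<in>?B. of_int (if h \<in> strips m n (f(i := f i - 1))
              then ?c f i else 0) * ?E h * ?S h)"
    by (subst sum.swap) (simp only: of_int_sum sum_distrib_left sum_distrib_right mult_ac)
  also have "\<dots> = (\<Sum>i=1..m. of_int (?c f i) * strip_sum m n (y # ys) (f(i := f i - 1)))"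
  proof (intro sum.cong refl)
    fix i assume i: "i \<in> {1..m}"
    have "(\<Sum>h\<in>?B. of_int (if h \<in> strips m n (f(i := f i - 1)) then ?c f i else 0) * ?E h * ?S h)
      = (\<Sum>h\<in>strips m n (f(i := f i - 1)). of_int (?c f i) * 
           (y ^ (?s h - ?s (f(i := f i - 1))) * ?S h))"
      using fin sB'[OF i] s2[OF i] by (intro sum.mono_neutral_cong_right) (auto simp: mult_ac)
    then show "(\<Sum>h\<in>?B. of_int (if h \<in> strips m n (f(i := f i - 1)) then ?c f i else 0) * ?E h * ?S h)
      = of_int (?c f i) * strip_sum m n (y # ys) (f(i := f i - 1))"
      by (simp only: strip_sum.simps sum_distrib_left)
  qed
  finally show ?case .
qed

section \<open>Strip sums as sums over bounded semistandard tableaux\<close>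

text \<open>The lower bound \<open>a\<close> counts the values already stripped off;
  \<open>a = 0\<close> admits all positive entries up to \<open>N\<close>.\<close>

definition bounded_tableaux ::
    "nat \<Rightarrow> nat \<Rightarrow> (nat \<times> nat) set \<Rightarrow> (nat \<times> nat \<Rightarrow> nat) set" where
  "bounded_tableaux a N D = {T \<in> D \<rightarrow>\<^sub>E {a<..N}. semistandard D T}"

lemma mem_rows: "(i, j) \<in> rows m n f \<longleftrightarrow> 1 \<le> i \<and> i \<le> m \<and> f i < j \<and> j \<le> n"
  by (auto simp: rows_def)

lemma finite_rows: "finite (rows m n f)"
  by (auto simp: rows_def)

lemma finite_bounded_tableaux: "finite D \<Longrightarrow> finite (bounded_tableaux a N D)"
  by (auto simp: bounded_tableaux_def intro: finite_subset[OF _ finite_PiE[of D "\<lambda>_. {a<..N}"]])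

text \<open>Applied to the columns in which a row has the minimal entry: they form an initial
  segment, hence are determined by their number.\<close>

lemma down_closed_card:
  fixes A :: "nat set"
  assumes "A \<subseteq> {l<..}" "finite A" "\<And>j j'. j \<in> A \<Longrightarrow> l < j' \<Longrightarrow> j' \<le> j \<Longrightarrow> j' \<in> A"
  shows "A = {l<..l + card A}"
proof (cases "A = {}")
  case False
  then have "Max A \<in> A" using assms(2) by simp
  have "A = {l<..Max A}"
  proof
    show "A \<subseteq> {l<..Max A}" using assms(1,2) by auto
    show "{l<..Max A} \<subseteq> A" using assms(3)[OF \<open>Max A \<in> A\<close>] by auto
  qed
  moreover have "l < Max A" using assms(1) \<open>Max A \<in> A\<close> by auto
  ultimately show ?thesis by (metis add_diff_inverse_nat card_greaterThanAtMost less_imp_le not_less)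
qed auto

lemma semistandard_row_mono:
  assumes "semistandard (rows m n f) T" "(i, j) \<in> rows m n f" "j \<le> j'" "j' \<le> n"
  shows "T (i, j) \<le> T (i, j')"
  using assms(3,4)
proof (induction j' rule: dec_induct)
  case (step k)
  have "(i, k) \<in> rows m n f" "(i, k + 1) \<in> rows m n f"
    using assms(2) step by (auto simp: mem_rows)
  then have "T (i, k) \<le> T (i, k + 1)" using assms(1) unfolding semistandard_def by blast
  with step show ?case by simp
qed simp

text \<open>The boxes with the smallest admitted entry \<open>Suc a\<close> form a horizontal strip along the inner
  boundary.\<close>

lemma tableaux_remove_minimum:
  fixes y :: "nat \<Rightarrow> 'a::comm_ring_1"
  assumes f: "inner_shape m n f" and aN: "a < N"
  shows "(\<Sum>T\<in>bounded_tableaux a N (rows m n f). \<Prod>p\<in>rows m n f. y (T p)) =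
    (\<Sum>g\<in>strips m n f. y (Suc a) ^ (sum g {1..m} - sum f {1..m}) *
       (\<Sum>T\<in>bounded_tableaux (Suc a) N (rows m n g). \<Prod>p\<in>rows m n g. y (T p)))"
proof -
  let ?R = "rows m n"
  let ?S = "\<lambda>a f. bounded_tableaux a N (?R f)"
  \<comment> \<open>\<open>F T\<close> marks where the entries \<open>Suc a\<close> end in each row;
    \<open>J\<close> is the inverse, refilling the removed strip with \<open>Suc a\<close>.\<close>
  define F where "F T = (\<lambda>i\<in>{1..m}. f i + card {j \<in> {f i<..n}. T (i, j) = Suc a})" for T
  define J where "J = (\<lambda>(g, T). \<lambda>p\<in>?R f. if p \<in> ?R g then T p else Suc a :: nat)"
  have strip: "f i \<le> g i" "g i \<le> n" "2 \<le> i \<Longrightarrow> g i \<le> f (i - 1)"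
    if "g \<in> strips m n f" "i \<in> {1..m}" for g i
    using mem_strips[OF that] upper_le[OF f that(2)] by (auto simp: upper_def)
  have sub: "?R g \<subseteq> ?R f" if "g \<in> strips m n f" for g
    using strip[OF that] by (fastforce simp: rows_def)
  have S1: "semistandard (?R f) T" "T \<in> extensional (?R f)"
     "\<And>p. p \<in> ?R f \<Longrightarrow> a < T p" "\<And>p. p \<in> ?R f \<Longrightarrow> T p \<le> N" if "T \<in> ?S a f" for T a f
    using that by (auto simp: bounded_tableaux_def PiE_def Pi_def)
  have key: "{j \<in> {f i<..n}. T (i, j) = Suc a} = {f i<..F T i}" 
    if T: "T \<in> ?S a f" and i: "i \<in> {1..m}" for T i
  proof -
    let ?A = "{j \<in> {f i<..n}. T (i, j) = Suc a}"
    have "?A = {f i<..f i + card ?A}"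
    proof (rule down_closed_card)
      fix j j' assume j: "j \<in> ?A" "f i < j'" "j' \<le> j"
      have "(i, j') \<in> ?R f" using j i by (auto simp: mem_rows)
      then have "a < T (i, j')" "T (i, j') \<le> T (i, j)"
        using S1(3)[OF T] semistandard_row_mono[OF S1(1)[OF T], of i j' j] j by auto
      then show "j' \<in> ?A" using j by auto
    qed auto
    then show ?thesis using i by (simp add: F_def)
  qed
  have val: "T (i, j) = Suc a \<longleftrightarrow> j \<le> F T i" if "T \<in> ?S a f" "(i, j) \<in> ?R f" for T i j
    using key[OF that(1), of i] that(2) by (auto simp: mem_rows set_eq_iff)
  have FT: "F T \<in> strips m n f" if T: "T \<in> ?S a f" for T
    unfolding strips_def
  proof (rule PiE_I)
    fix i assume i: "i \<in> {1..m}"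
    have "{f i<..F T i} \<subseteq> {..n}" using key[OF T i] by auto
    then have Fn: "F T i \<le> n"
      using inner_shape_le[OF f, of i] i by (cases "f i < F T i") auto
    \<comment> \<open>Otherwise a minimal entry would have a box directly above it, with a still
      smaller entry.\<close>
    have "F T i \<le> f (i - 1)" if i2: "i \<noteq> 1"
    proof (rule ccontr)
      assume "\<not> F T i \<le> f (i - 1)"
      moreover have "f i \<le> f (i - 1)" using inner_shape_antimono[OF f, of "i - 1" i] i i2 by auto
      ultimately have p: "(i - 1, F T i) \<in> ?R f" "(i - 1 + 1, F T i) \<in> ?R f"
        using i i2 Fn by (auto simp: mem_rows)
      then have "T (i - 1, F T i) < T (i - 1 + 1, F T i)"
        using S1(1)[OF T] unfolding semistandard_def by blast
      moreover have "i - 1 + 1 = i" using i by simp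
      ultimately show False using S1(3)[OF T p(1)] val[OF T, of i "F T i"] p by simp
    qed
    then show "F T i \<in> {f i..upper n f i}" using Fn i by (auto simp: upper_def F_def)
  qed (auto simp: F_def)
  have rowsF: "p \<in> ?R (F T) \<longleftrightarrow> p \<in> ?R f \<and> T p \<noteq> Suc a" if T: "T \<in> ?S a f" for T p
  proof (cases p)
    case (Pair i j)
    show ?thesis using val[OF T, of i j] strip[OF FT[OF T], of i] unfolding Pair
      by (auto simp: mem_rows)
  qed
  have JS: "J (g, T) \<in> ?S a f" if g: "g \<in> strips m n f" and T: "T \<in> ?S (Suc a) g" for g T
  proof -
    note s = S1[OF T]
    have "semistandard (?R f) (J (g, T))"
      unfolding semistandard_def
    proof (intro conjI allI impI; elim conjE)
      fix i j assume p: "(i, j) \<in> ?R f" "(i + 1, j) \<in> ?R f"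
      \<comment> \<open>A box below another box of the diagram is outside the strip, so no column
        compares two entries \<open>Suc a\<close>.\<close>
      have "i + 1 \<in> {1..m}" using p by (auto simp: mem_rows)
      then have "g (i + 1) \<le> f i" using strip(3)[OF g, of "i + 1"] p by (auto simp: mem_rows)
      then have q: "(i + 1, j) \<in> ?R g" using p by (auto simp: mem_rows)
      show "J (g, T) (i, j) < J (g, T) (i + 1, j)"
      proof (cases "(i, j) \<in> ?R g")
        case True
        then have "T (i, j) < T (i + 1, j)" using q s(1) unfolding semistandard_def by blast
        then show ?thesis using True p q by (simp add: J_def)
      next
        case False
        then show ?thesis using p q s(3)[OF q] by (simp add: J_def)
      qed
    next
      fix i j assume p: "(i, j) \<in> ?R f" "(i, j + 1) \<in> ?R f"
      show "J (g, T) (i, j) \<le> J (g, T) (i, j + 1)"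
      proof (cases "(i, j) \<in> ?R g")
        case True
        then have q: "(i, j + 1) \<in> ?R g" using p by (auto simp: mem_rows)
        then have "T (i, j) \<le> T (i, j + 1)" using True s(1) unfolding semistandard_def by blast
        then show ?thesis using True p q by (simp add: J_def)
      next
        case False
        then show ?thesis using p s(3)[of "(i, j + 1)"] by (auto simp: J_def)
      qed
    qed
    moreover have "J (g, T) \<in> ?R f \<rightarrow>\<^sub>E {a<..N}"
      using s(3,4) aN by (force simp: J_def)
    ultimately show ?thesis by (simp add: bounded_tableaux_def)
  qed
  have FJ: "F (J (g, T)) = g" if g: "g \<in> strips m n f" and T: "T \<in> ?S (Suc a) g" for g T
  proof
    fix i
    show "F (J (g, T)) i = g i"
    proof (cases "i \<in> {1..m}")
      case True
      have "J (g, T) (i, j) = Suc a \<longleftrightarrow> j \<le> g i" if p: "(i, j) \<in> ?R f" for j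
      proof (cases "(i, j) \<in> ?R g")
        case True
        then show ?thesis using S1(3)[OF T True] p by (auto simp: J_def mem_rows)
      next
        case False
        then show ?thesis using p by (auto simp: J_def mem_rows)
      qed
      then have "{j \<in> {f i<..n}. J (g, T) (i, j) = Suc a} = {f i<..g i}"
        using True strip(2)[OF g True] by (auto simp: mem_rows)
      then show ?thesis using True strip(1)[OF g True] by (simp add: F_def)
    next
      case False
      then show ?thesis using g by (auto simp: F_def strips_def PiE_def extensional_def)
    qed
  qed
  have size: "card (?R f - ?R g) = sum g {1..m} - sum f {1..m}" if g: "g \<in> strips m n f" for g
  proof -
    have "?R f - ?R g = (SIGMA i:{1..m}. {f i<..g i})"
      using strip[OF g] by (fastforce simp: rows_def)
    then have "card (?R f - ?R g) = (\<Sum>i\<in>{1..m}. g i - f i)" by simp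
    also have "\<dots> = sum g {1..m} - sum f {1..m}"
      using strip(1)[OF g] by (intro sum_subtractf_nat) auto
    finally show ?thesis .
  qed
  have "(\<Sum>T\<in>?S a f. \<Prod>p\<in>?R f. y (T p)) =
    (\<Sum>(g, T)\<in>Sigma (strips m n f) (?S (Suc a)). y (Suc a) ^ (sum g {1..m} - sum f {1..m}) *
       (\<Prod>p\<in>?R g. y (T p)))"
  proof (rule sum.reindex_bij_witness[where i = J and j = "\<lambda>T. (F T, restrict T (?R (F T)))"])
    fix T assume T: "T \<in> ?S a f"
    show "J (F T, restrict T (?R (F T))) = T"
    proof
      fix p show "J (F T, restrict T (?R (F T))) p = T p"
        using rowsF[OF T, of p] extensional_arb[OF S1(2)[OF T], of p] by (auto simp: J_def)
    qed
    have "semistandard (?R (F T)) T"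
      using S1(1)[OF T] sub[OF FT[OF T]] unfolding semistandard_def by blast
    then have "restrict T (?R (F T)) \<in> ?S (Suc a) (F T)"
      using S1(3,4)[OF T] rowsF[OF T]
      by (auto simp: bounded_tableaux_def semistandard_def Suc_lessI)
    then show "(F T, restrict T (?R (F T))) \<in> Sigma (strips m n f) (?S (Suc a))"
      using FT[OF T] by simp
    have "(\<Prod>p\<in>?R f. y (T p)) = (\<Prod>p\<in>?R f - ?R (F T). y (T p)) * (\<Prod>p\<in>?R (F T). y (T p))"
      by (rule prod.subset_diff[OF sub[OF FT[OF T]] finite_rows])
    also have "(\<Prod>p\<in>?R f - ?R (F T). y (T p)) = (\<Prod>p\<in>?R f - ?R (F T). y (Suc a))"
      using rowsF[OF T] by (intro prod.cong refl) auto
    finally show "(case (F T, restrict T (?R (F T))) of (g, T) \<Rightarrow>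
       y (Suc a) ^ (sum g {1..m} - sum f {1..m}) * (\<Prod>p\<in>?R g. y (T p))) = (\<Prod>p\<in>?R f. y (T p))"
      using size[OF FT[OF T]] by simp
  next
    fix x assume "x \<in> Sigma (strips m n f) (?S (Suc a))"
    then obtain g T where x: "x = (g, T)" and g: "g \<in> strips m n f" and T: "T \<in> ?S (Suc a) g"
      by blast
    show "J x \<in> ?S a f" using JS[OF g T] x by simp
    have "restrict (J (g, T)) (?R g) = T"
    proof
      fix p show "restrict (J (g, T)) (?R g) p = T p"
        using sub[OF g] extensional_arb[OF S1(2)[OF T], of p] by (cases "p \<in> ?R g") (auto simp: J_def)
    qed
    then show "(F (J x), restrict (J x) (?R (F (J x)))) = x" using FJ[OF g T] x by simp
  qed
  also have "\<dots> = (\<Sum>g\<in>strips m n f. \<Sum>T\<in>?S (Suc a) g.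
      y (Suc a) ^ (sum g {1..m} - sum f {1..m}) * (\<Prod>p\<in>?R g. y (T p)))"
    by (rule sum.Sigma[symmetric]) (auto simp: finite_strips finite_bounded_tableaux finite_rows)
  finally show ?thesis by (simp only: sum_distrib_left)
qed

text \<open>Iterates the removal of minimal entries, by induction downwards from
  \<open>a = N\<close>. There no entry is available, so only the empty diagram has a
  tableau.\<close>

lemma sum_bounded_tableaux:
  fixes y :: "nat \<Rightarrow> 'a::comm_ring_1"
  assumes "inner_shape m n f" "a \<le> N"
  shows "(\<Sum>T\<in>bounded_tableaux a N (rows m n f). \<Prod>p\<in>rows m n f. y (T p)) =
    strip_sum m n (map y [Suc a..<Suc N]) f"
  using assms(2,1)
proof (induction a arbitrary: f rule: inc_induct)
  case base
  show ?case
  proof (cases "\<forall>i\<in>{1..m}. f i = n")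
    case True
    then have "rows m n f = {}" by (auto simp: rows_def)
    with True show ?thesis by (simp add: bounded_tableaux_def semistandard_def)
  next
    case False
    then obtain i where "i \<in> {1..m}" "f i < n"
      using inner_shape_le[OF base] by (metis atLeastAtMost_iff le_neq_implies_less)
    then have "(i, n) \<in> rows m n f" by (auto simp: mem_rows)
    then have "bounded_tableaux N N (rows m n f) = {}"
      by (auto simp: bounded_tableaux_def PiE_def Pi_def)
    with False show ?thesis by auto
  qed
next
  case (step a)
  have "map y [Suc a..<Suc N] = y (Suc a) # map y [Suc (Suc a)..<Suc N]"
    using step.hyps by (simp add: upt_conv_Cons del: upt_Suc)
  then show ?case
    using tableaux_remove_minimum[OF step.prems, of a N y] step
    by (simp add: inner_shape_strips del: upt_Suc cong: sum.cong)
qed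

section \<open>The corner box\<close>

text \<open>Move right to the end of row \<open>i\<close>, then down the last column; as the inner
  parts are non-increasing, this path stays in the diagram.\<close>

lemma semistandard_le_corner:
  assumes "inner_shape m n f" "semistandard (rows m n f) T" "(i, j) \<in> rows m n f"
  shows "T (i, j) \<le> T (m, n)"
proof -
  have r: "1 \<le> i" "i \<le> m" "f i < j" "j \<le> n" using assms(3) by (auto simp: mem_rows)
  have "T (i, n) \<le> T (i', n)" if "i \<le> i'" "i' \<le> m" for i'
    using that
  proof (induction i' rule: dec_induct)
    case (step k)
    have "f k \<le> f i" "f (k + 1) \<le> f i"
      using inner_shape_antimono[OF assms(1), of i] r step by auto
    then have "(k, n) \<in> rows m n f" "(k + 1, n) \<in> rows m n f"
      using r step by (auto simp: mem_rows)
    then have "T (k, n) < T (k + 1, n)" using assms(2) unfolding semistandard_def by blast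
    with step show ?case by simp
  qed simp
  moreover have "T (i, j) \<le> T (i, n)"
    using semistandard_row_mono[OF assms(2,3)] r by simp
  ultimately show ?thesis using r order_trans by blast
qed

lemma corners_rows:
  assumes "inner_shape m n f" "f m < n" "m \<ge> 1"
  shows "corners (rows m n f) = {(m, n)}"
proof -
  have "i = m" "j = n" if "(i, j) \<in> rows m n f" "(i, j + 1) \<notin> rows m n f" "(i + 1, j) \<notin> rows m n f" for i j
  proof -
    show "j = n" using that by (auto simp: mem_rows)
    show "i = m"
      using that inner_shape_antimono[OF assms(1), of i "i + 1"] by (force simp: mem_rows)
  qed
  then show ?thesis using assms(2,3) by (auto simp: corners_def mem_rows)
qed

section \<open>Generating series for the sums over exponents\<close>

text \<open>The power series of \<open>1 / (a - X)\<close>.\<close>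

definition geom :: "nat \<Rightarrow> real fps" where
  "geom a = Abs_fps (\<lambda>k. (1 / real a) ^ Suc k)"

text \<open>The relation under which \<open>deriv_strip_sum\<close> applies: all
  \<open>k + 1\<close> products in the convolution are the same power.\<close>

lemma fps_deriv_geom: "fps_deriv (geom a) = geom a ^ 2"
proof (rule fps_ext)
  fix k
  have "fps_nth (geom a ^ 2) k = (\<Sum>i=0..k. (1 / real a) ^ Suc i * (1 / real a) ^ Suc (k - i))"
    by (simp add: power2_eq_square fps_mult_nth geom_def)
  also have "\<dots> = (\<Sum>i=0..k. (1 / real a) ^ (k + 2))"
    by (intro sum.cong refl) (simp only: power_add[symmetric], simp)
  finally show "fps_nth (fps_deriv (geom a)) k = fps_nth (geom a ^ 2) k" by (simp add: geom_def)
qed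

text \<open>The Cauchy product for several factors; extensional functions list each distribution of
  \<open>w\<close> over \<open>A\<close> once.\<close>

lemma fps_prod_nth_PiE:
  fixes z :: "'b \<Rightarrow> 'a::comm_ring_1 fps"
  assumes "finite A"
  shows "fps_nth (\<Prod>p\<in>A. z p) w = (\<Sum>k\<in>{k \<in> A \<rightarrow>\<^sub>E UNIV. sum k A = w}. \<Prod>p\<in>A. fps_nth (z p) (k p))"
  using assms
proof (induction A arbitrary: w rule: finite_induct)
  case empty
  have "{k \<in> {} \<rightarrow>\<^sub>E (UNIV :: nat set). sum k {} = w} = (if w = 0 then {\<lambda>_. undefined} else {})"
    by auto
  then show ?case by simp
next
  case (insert a A)
  have fin: "finite {k \<in> A \<rightarrow>\<^sub>E UNIV. sum k A = v}" for v :: nat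
    using insert.hyps(1)
    by (intro finite_subset[OF _ finite_PiE[of A "\<lambda>_. {..v}"]])
      (auto simp: PiE_def Pi_def intro: member_le_sum)
  have "fps_nth (\<Prod>p\<in>insert a A. z p) w =
     (\<Sum>i=0..w. \<Sum>k\<in>{k \<in> A \<rightarrow>\<^sub>E UNIV. sum k A = w - i}. fps_nth (z a) i * (\<Prod>p\<in>A. fps_nth (z p) (k p)))"
    using insert by (simp add: fps_mult_nth sum_distrib_left)
  also have "\<dots> = (\<Sum>(i, k)\<in>(SIGMA i:{0..w}. {k \<in> A \<rightarrow>\<^sub>E UNIV. sum k A = w - i}).
      fps_nth (z a) i * (\<Prod>p\<in>A. fps_nth (z p) (k p)))"
    using fin by (intro sum.Sigma) auto
  also have "\<dots> = (\<Sum>k\<in>{k \<in> insert a A \<rightarrow>\<^sub>E UNIV. sum k (insert a A) = w}. 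
      \<Prod>p\<in>insert a A. fps_nth (z p) (k p))"
  \<comment> \<open>Splitting off \<open>k a\<close> resets \<open>k\<close> at \<open>a\<close> to
    \<open>undefined\<close>, the value that extensional functions on \<open>A\<close> take
    there.\<close>
  proof (rule sum.reindex_bij_witness[where i = "\<lambda>k. (k a, k(a := undefined))"
        and j = "\<lambda>(i, k). k(a := i)"])
    have upd: "sum (k(a := i)) A = sum k A" "(\<Prod>p\<in>A. fps_nth (z p) ((k(a := i)) p)) = (\<Prod>p\<in>A. fps_nth (z p) (k p))"
      for k :: "'b \<Rightarrow> nat" and i
      using insert.hyps(2) by (auto intro!: sum.cong prod.cong)
    fix x assume x: "x \<in> (SIGMA i:{0..w}. {k \<in> A \<rightarrow>\<^sub>E UNIV. sum k A = w - i})"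
    then obtain i k where ik: "x = (i, k)" "i \<le> w" "k \<in> extensional A" "sum k A = w - i"
      by (auto simp: PiE_def)
    have "k a = undefined" using ik insert.hyps(2) by (simp add: extensional_def)
    then show "((case x of (i, k) \<Rightarrow> k(a := i)) a, (case x of (i, k) \<Rightarrow> k(a := i))(a := undefined)) = x"
      using ik by (auto simp: fun_eq_iff)
    show "(case x of (i, k) \<Rightarrow> k(a := i)) \<in> {k \<in> insert a A \<rightarrow>\<^sub>E UNIV. sum k (insert a A) = w}"
      using ik insert.hyps upd(1)[of k i] by (auto simp: PiE_def extensional_def)
    show "(\<Prod>p\<in>insert a A. fps_nth (z p) ((case x of (i, k) \<Rightarrow> k(a := i)) p)) =
       (case x of (i, k) \<Rightarrow> fps_nth (z a) i * (\<Prod>p\<in>A. fps_nth (z p) (k p)))"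
      using ik insert.hyps upd(2)[of k i] by simp
  next
    fix k assume k: "k \<in> {k \<in> insert a A \<rightarrow>\<^sub>E UNIV. sum k (insert a A) = w}"
    have "sum (k(a := undefined)) A = sum k A"
      using insert.hyps(2) by (auto intro!: sum.cong)
    then show "(k a, k(a := undefined)) \<in> (SIGMA i:{0..w}. {k \<in> A \<rightarrow>\<^sub>E UNIV. sum k A = w - i})"
      using k insert.hyps by (auto simp: PiE_def extensional_def)
  qed simp
  finally show ?case .
qed

definition exponents :: "nat \<Rightarrow> (nat \<times> nat) set \<Rightarrow> (nat \<times> nat \<Rightarrow> nat) set" where
  "exponents w D = {k \<in> tableaux D. admissible D k \<and> weight D k = w}"

text \<open>Exponents from 1 on contribute \<open>fps_X * geom (T p)\<close>; at the corner,
  exponents from 2 on contribute \<open>fps_X ^ 2 * geom (T c)\<close> times \<open>1 / T c\<close>.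
  Collecting the powers of \<open>fps_X\<close> shifts the coefficient by \<open>card D + 1\<close>,
  and for smaller \<open>w\<close> it is 0.\<close>

lemma sum_exponents:
  assumes D: "finite D" and c: "corners D = {c}"
  shows "(\<Sum>k\<in>exponents w D. \<Prod>p\<in>D. 1 / real (T p) ^ k p) =
    (if card D < w then 1 / real (T c) * fps_nth (\<Prod>p\<in>D. geom (T p)) (w - card D - 1) else 0)"
proof -
  have "c \<in> corners D" using c by simp
  then have cD: "c \<in> D" by (auto simp: corners_def)
  define z where "z p = (if p = c then fps_X ^ 2 * (fps_const (1 / real (T c)) * geom (T c))
      else fps_X ^ 1 * geom (T p))" for p
  have z: "fps_nth (z p) l = (if 1 \<le> l \<and> (p = c \<longrightarrow> 2 \<le> l) then 1 / real (T p) ^ l else 0)" for p l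
  proof -
    consider "l = 0" | "l = 1" | r where "l = Suc (Suc r)" by (metis One_nat_def not0_implies_Suc)
    then show ?thesis
      by cases (auto simp: z_def fps_X_power_mult_nth geom_def power_one_over simp del: power_one_right)
  qed
  have "(\<Sum>k\<in>exponents w D. \<Prod>p\<in>D. 1 / real (T p) ^ k p) = (\<Sum>k\<in>exponents w D. \<Prod>p\<in>D. fps_nth (z p) (k p))"
    using c by (intro sum.cong prod.cong refl)
      (auto simp: z exponents_def tableaux_def admissible_def PiE_def Pi_def)
  \<comment> \<open>The added \<open>k\<close> have an exponent 0 somewhere or an exponent below 2
    at the corner, where the coefficient of \<open>z\<close> vanishes.\<close>
  also have "\<dots> = (\<Sum>k\<in>{k \<in> D \<rightarrow>\<^sub>E UNIV. sum k D = w}. \<Prod>p\<in>D. fps_nth (z p) (k p))"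
  proof (rule sum.mono_neutral_left)
    show "finite {k \<in> D \<rightarrow>\<^sub>E UNIV. sum k D = w}"
      using D by (intro finite_subset[OF _ finite_PiE[of D "\<lambda>_. {..w}"]])
        (auto simp: PiE_def Pi_def intro: member_le_sum)
    show "exponents w D \<subseteq> {k \<in> D \<rightarrow>\<^sub>E UNIV. sum k D = w}"
      by (auto simp: exponents_def tableaux_def weight_def)
    have "\<exists>p\<in>D. fps_nth (z p) (k p) = 0" if "k \<in> D \<rightarrow>\<^sub>E UNIV" "sum k D = w" "k \<notin> exponents w D" for k
    proof (cases "k c \<ge> 2")
      case True
      with that c show ?thesis
        by (auto simp: exponents_def tableaux_def weight_def admissible_def PiE_def Pi_def z)
    next
      case False
      then show ?thesis using cD by (auto simp: z)
    qed
    then show "\<forall>k\<in>{k \<in> D \<rightarrow>\<^sub>E UNIV. sum k D = w} - exponents w D. (\<Prod>p\<in>D. fps_nth (z p) (k p)) = 0"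
      using D by (auto intro: prod_zero)
  qed
  also have "\<dots> = fps_nth (\<Prod>p\<in>D. z p) w" by (rule fps_prod_nth_PiE[OF D, symmetric])
  also have "(\<Prod>p\<in>D. z p) = fps_X ^ (card D + 1) * (fps_const (1 / real (T c)) * (\<Prod>p\<in>D. geom (T p)))"
  proof -
    have "(\<Prod>p\<in>D. z p) = z c * (\<Prod>p\<in>D - {c}. fps_X * geom (T p))"
      using D cD by (subst prod.remove[of D c]) (auto simp: z_def intro!: prod.cong)
    also have "\<dots> = (fps_X * (\<Prod>p\<in>D - {c}. fps_X)) * fps_X
        * (fps_const (1 / real (T c)) * (geom (T c) * (\<Prod>p\<in>D - {c}. geom (T p))))"
      by (simp add: z_def prod.distrib power2_eq_square mult_ac)
    also have "fps_X * (\<Prod>p\<in>D - {c}. fps_X) = (fps_X ^ card D :: real fps)"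
      using prod.remove[OF D cD, of "\<lambda>_. fps_X :: real fps"] by simp
    also have "geom (T c) * (\<Prod>p\<in>D - {c}. geom (T p)) = (\<Prod>p\<in>D. geom (T p))"
      by (rule prod.remove[OF D cD, symmetric])
    finally show ?thesis by (simp add: mult_ac)
  qed
  finally show ?thesis unfolding fps_X_power_mult_nth by (simp add: not_less)
qed

section \<open>Convergence, and grouping by the corner entry\<close>

text \<open>Each term is at most the product of all \<open>T p powr s\<close> for some
  \<open>s < -1\<close>. Over a cube of fillings that product sums to a power of a partial sum of a
  convergent series, which bounds all finite sums by \<open>C ^ card D\<close>.\<close>

lemma summable_on_tableaux:
  fixes k :: "'b \<Rightarrow> nat"
  assumes D: "finite D" "c \<in> D" and k: "\<And>p. p \<in> D \<Longrightarrow> 1 \<le> k p" "2 \<le> k c"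
    and A: "A \<subseteq> D \<rightarrow>\<^sub>E {1..}" "\<And>T p. T \<in> A \<Longrightarrow> p \<in> D \<Longrightarrow> T p \<le> T c"
  shows "(\<lambda>T. \<Prod>p\<in>D. 1 / real (T p) ^ k p) summable_on A"
proof -
  define d where "d = card D"
  have d: "d > 0" using D by (auto simp: d_def card_gt_0_iff)
  define s where "s = - 1 - 1 / real d"
  define C where "C = (\<Sum>a. real a powr s)"
  have sumC: "summable (\<lambda>a. real a powr s)"
    unfolding summable_real_powr_iff s_def using d by simp
  \<comment> \<open>The corner carries the largest entry, so one of its two factors \<open>1 / T c\<close> can be shared out
    among all boxes.\<close>
  have bound: "(\<Prod>p\<in>D. 1 / real (T p) ^ k p) \<le> (\<Prod>p\<in>D. real (T p) powr s)" if T: "T \<in> A" for T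
  proof -
    have T1: "1 \<le> T p" if "p \<in> D" for p using T A(1) that by (auto simp: PiE_def Pi_def)
    then have T0: "0 < T p" if "p \<in> D" for p using that by fastforce
    have le: "1 / real (T p) ^ k p \<le> 1 / real (T p) ^ l" if "p \<in> D" "l \<le> k p" for p l
      using T1[OF that(1)] that(2) by (intro divide_left_mono power_increasing) auto
    have "(\<Prod>p\<in>D. 1 / real (T p) ^ k p)
       = 1 / real (T c) ^ k c * (\<Prod>p\<in>D - {c}. 1 / real (T p) ^ k p)"
      by (rule prod.remove[OF D])
    also have "\<dots> \<le> 1 / real (T c) ^ 2 * (\<Prod>p\<in>D - {c}. 1 / real (T p) ^ 1)"
      using le[OF D(2) k(2)] le[of _ 1] k(1) by (intro mult_mono prod_mono) (auto intro!: prod_nonneg)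
    also have "\<dots> = 1 / real (T c) * (1 / real (T c) * (\<Prod>p\<in>D - {c}. 1 / real (T p)))"
      by (simp add: power2_eq_square)
    also have "1 / real (T c) * (\<Prod>p\<in>D - {c}. 1 / real (T p)) = (\<Prod>p\<in>D. 1 / real (T p))"
      by (rule prod.remove[OF D, symmetric])
    also have "1 / real (T c) = (\<Prod>p\<in>D. real (T c) powr (- 1 / real d))"
    proof -
      have "(\<Prod>p\<in>D. real (T c) powr (- 1 / real d)) = real (T c) powr (real d * (- 1 / real d))"
        using d T1[OF D(2)] by (simp only: prod_constant flip: d_def) (rule powr_power, simp)
      also have "\<dots> = 1 / real (T c)"
        using d T1[OF D(2)] by (simp add: powr_minus_divide)
      finally show ?thesis by simp
    qed
    also have "\<dots> * (\<Prod>p\<in>D. 1 / real (T p)) \<le>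
        (\<Prod>p\<in>D. real (T p) powr (- 1 / real d)) * (\<Prod>p\<in>D. 1 / real (T p))"
      using T0 A(2)[OF T] by (intro mult_right_mono prod_mono conjI powr_mono2') (auto intro!: prod_nonneg)
    also have "\<dots> = (\<Prod>p\<in>D. real (T p) powr s)"
      unfolding prod.distrib[symmetric]
    proof (intro prod.cong refl)
      fix p assume "p \<in> D"
      then have "real (T p) > 0" using T0[of p] by simp
      then show "real (T p) powr (- 1 / real d) * (1 / real (T p)) = real (T p) powr s"
        by (simp add: s_def powr_diff powr_minus_divide field_simps)
    qed
    finally show ?thesis .
  qed
  show ?thesis
  proof (rule nonneg_bdd_above_summable_on)
    have "(\<Sum>T\<in>F. \<Prod>p\<in>D. 1 / real (T p) ^ k p) \<le> C ^ card D" if F: "F \<subseteq> A" "finite F" for F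
    proof -
      define M where "M = Max (insert 0 ((\<lambda>T. T c) ` F))"
      have M: "T p \<le> M" if "T \<in> F" "p \<in> D" for T p
      proof -
        have "T c \<le> M" using that F by (simp add: M_def)
        then show ?thesis using A(2)[of T p] that F by auto
      qed
      have sub: "F \<subseteq> D \<rightarrow>\<^sub>E {..M}"
      proof
        fix T assume "T \<in> F"
        then have "T \<in> D \<rightarrow>\<^sub>E {1..}" using F A(1) by blast
        then show "T \<in> D \<rightarrow>\<^sub>E {..M}" using M[OF \<open>T \<in> F\<close>] by (auto simp: PiE_iff)
      qed
      have "(\<Sum>T\<in>F. \<Prod>p\<in>D. 1 / real (T p) ^ k p) \<le> (\<Sum>T\<in>F. \<Prod>p\<in>D. real (T p) powr s)"
        using bound F by (intro sum_mono) auto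
      \<comment> \<open>The cube includes the entry 0, which contributes nothing as
        \<open>0 powr s = 0\<close>.\<close>
      also have "\<dots> \<le> (\<Sum>T\<in>D \<rightarrow>\<^sub>E {..M}. \<Prod>p\<in>D. real (T p) powr s)"
        using sub D by (intro sum_mono2) (auto intro!: finite_PiE prod_nonneg)
      also have "\<dots> = (\<Prod>p\<in>D. \<Sum>a\<le>M. real a powr s)"
        using D by (intro prod_sum_PiE[symmetric]) auto
      also have "\<dots> \<le> (\<Prod>p\<in>D. C)"
        unfolding C_def by (intro prod_mono conjI sum_nonneg sum_le_suminf sumC) auto
      finally show ?thesis by simp
    qed
    then show "bdd_above (sum (\<lambda>T. \<Prod>p\<in>D. 1 / real (T p) ^ k p) ` {F. F \<subseteq> A \<and> finite F})"
      by (intro bdd_aboveI[of _ "C ^ card D"]) auto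
  qed (auto intro!: prod_nonneg)
qed

text \<open>The corner holds the largest entry, so the tableaux with corner at most \<open>N\<close>
  form the finite set \<open>bounded_tableaux 0 N\<close>. These sets exhaust all tableaux, and the
  unconditional sum can be taken along them. Entries start at 1, hence the corner
  \<open>Suc M\<close>.\<close>

lemma corner_tableaux_sums:
  assumes f: "inner_shape m n f" "f m < n" "m \<ge> 1"
    and k: "k \<in> exponents w (rows m n f)"
  shows "(\<lambda>M. \<Sum>T\<in>{T \<in> bounded_tableaux 0 (Suc M) (rows m n f). T (m, n) = Suc M}.
      \<Prod>p\<in>rows m n f. 1 / real (T p) ^ k p) sums schur_zeta (rows m n f) k"
proof -
  let ?D = "rows m n f" and ?t = "\<lambda>T. \<Prod>p\<in>rows m n f. 1 / real (T p) ^ k p"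
  let ?A = "{T \<in> tableaux ?D. semistandard ?D T}" and ?B = "\<lambda>N. bounded_tableaux 0 N ?D"
  have c: "(m, n) \<in> ?D" using f by (simp add: mem_rows)
  have kp: "1 \<le> k p" if "p \<in> ?D" for p
    using k PiE_mem[of k ?D "\<lambda>_. {1..}", OF _ that] by (auto simp: exponents_def tableaux_def)
  have kc: "2 \<le> k (m, n)"
    using k corners_rows[OF f] by (simp add: exponents_def admissible_def)
  have top: "T p \<le> T (m, n)" if "semistandard ?D T" "p \<in> ?D" for T p
    using semistandard_le_corner[OF f(1) that(1)] that(2) by (cases p) auto
  have "?t summable_on ?A"
    using kp kc top by (intro summable_on_tableaux[OF finite_rows c]) (auto simp: tableaux_def)
  then have "(?t has_sum schur_zeta ?D k) ?A"
    unfolding schur_zeta_def by (rule has_sum_infsum)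
  then have lim: "(sum ?t \<longlongrightarrow> schur_zeta ?D k) (finite_subsets_at_top ?A)"
    by (simp add: has_sum_def)
  have "filterlim ?B (finite_subsets_at_top ?A) sequentially"
    unfolding filterlim_finite_subsets_at_top
  proof (intro allI impI, elim conjE)
    fix X assume X: "finite X" "X \<subseteq> ?A"
    \<comment> \<open>Bounds the corners in \<open>X\<close>, hence all entries there; the inserted
      0 covers empty \<open>X\<close>.\<close>
    define N where "N = Max (insert 0 ((\<lambda>T. T (m, n)) ` X))"
    have "X \<subseteq> ?B M" if "M \<ge> N" for M
    proof
      fix T assume T: "T \<in> X"
      then have TA: "T \<in> tableaux ?D" "semistandard ?D T" using X by auto
      have "T (m, n) \<le> N" using T X by (auto simp: N_def)
      then have "T p \<le> M" if "p \<in> ?D" for p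
        using top[OF TA(2) that] \<open>M \<ge> N\<close> by simp
      then show "T \<in> ?B M"
        using TA by (fastforce simp: bounded_tableaux_def tableaux_def PiE_def Pi_def)
    qed
    moreover have "?B M \<subseteq> ?A" for M
      by (fastforce simp: bounded_tableaux_def tableaux_def PiE_def Pi_def)
    ultimately show "eventually (\<lambda>M. finite (?B M) \<and> X \<subseteq> ?B M \<and> ?B M \<subseteq> ?A) sequentially"
      using finite_bounded_tableaux[OF finite_rows]
      by (auto simp: eventually_sequentially)
  qed
  from filterlim_compose[OF lim this] have "(\<lambda>N. sum ?t (?B N)) \<longlonglongrightarrow> schur_zeta ?D k" .
  moreover have "sum ?t (?B N) = (\<Sum>M<N. sum ?t {T \<in> ?B (Suc M). T (m, n) = Suc M})" for N
  proof (induction N)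
    case 0
    have "?B 0 = {}" using c by (auto simp: bounded_tableaux_def PiE_def Pi_def)
    then show ?case by simp
  next
    case (Suc N)
    have "?B (Suc N) = ?B N \<union> {T \<in> ?B (Suc N). T (m, n) = Suc N}" (is "_ = _ \<union> ?C")
    proof (intro equalityI subsetI)
      fix T assume T: "T \<in> ?B (Suc N)"
      then have T': "T \<in> ?D \<rightarrow>\<^sub>E {0<..Suc N}" "semistandard ?D T" by (auto simp: bounded_tableaux_def)
      show "T \<in> ?B N \<union> ?C"
      proof (cases "T (m, n) = Suc N")
        case False
        moreover have "T (m, n) \<le> Suc N" using T' c by (auto simp: PiE_def Pi_def)
        ultimately have "T p \<le> N" if "p \<in> ?D" for p using top[OF T'(2) that] by simp
        then have "T \<in> ?B N" using T' by (fastforce simp: bounded_tableaux_def PiE_def Pi_def)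
        then show ?thesis by simp
      qed (use T in simp)
    next
      fix T assume "T \<in> ?B N \<union> ?C"
      then show "T \<in> ?B (Suc N)" by (fastforce simp: bounded_tableaux_def PiE_def Pi_def)
    qed
    moreover have "?B N \<inter> ?C = {}"
      using c by (fastforce simp: bounded_tableaux_def PiE_def Pi_def)
    ultimately have "sum ?t (?B (Suc N)) = sum ?t (?B N) + sum ?t ?C"
      using finite_bounded_tableaux[OF finite_rows]
      by (metis (no_types, lifting) finite_Un sum.union_disjoint)
    then show ?case using Suc by simp
  qed
  ultimately show ?thesis by (simp add: sums_def)
qed

section \<open>The identity for each value of the corner entry\<close>

text \<open>As the corner is the maximum, corner \<open>Suc M\<close> means entries at most
  \<open>Suc M\<close> but not all at most \<open>M\<close>.\<close>

lemma sum_corner_tableaux: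
  fixes y :: "nat \<Rightarrow> 'a::comm_ring_1"
  assumes f: "inner_shape m n f" "f m < n" "m \<ge> 1"
  shows "(\<Sum>T\<in>{T \<in> bounded_tableaux 0 (Suc M) (rows m n f). T (m, n) = Suc M}.
      \<Prod>p\<in>rows m n f. y (T p)) =
    strip_sum m n (map y [1..<Suc (Suc M)]) f - strip_sum m n (map y [1..<Suc M]) f"
proof -
  let ?D = "rows m n f"
  let ?B = "\<lambda>N. bounded_tableaux 0 N ?D"
  let ?C = "{T \<in> ?B (Suc M). T (m, n) = Suc M}"
  have c: "(m, n) \<in> ?D" using f by (simp add: mem_rows)
  have "?B (Suc M) - ?C = ?B M"
  proof (intro equalityI subsetI)
    fix T assume T: "T \<in> ?B (Suc M) - ?C"
    then have T': "T \<in> ?D \<rightarrow>\<^sub>E {0<..Suc M}" "semistandard ?D T" by (auto simp: bounded_tableaux_def)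
    have "T (m, n) \<le> Suc M" using T' c by (auto simp: PiE_def Pi_def)
    then have "T (i, j) \<le> M" if "(i, j) \<in> ?D" for i j
      using semistandard_le_corner[OF f(1) T'(2) that] T by auto
    then show "T \<in> ?B M" using T' by (fastforce simp: bounded_tableaux_def PiE_def Pi_def)
  next
    fix T assume "T \<in> ?B M"
    then show "T \<in> ?B (Suc M) - ?C"
      using c by (fastforce simp: bounded_tableaux_def PiE_def Pi_def)
  qed
  moreover have "(\<Sum>T\<in>?B (Suc M). \<Prod>p\<in>?D. y (T p)) =
     (\<Sum>T\<in>?B (Suc M) - ?C. \<Prod>p\<in>?D. y (T p)) + (\<Sum>T\<in>?C. \<Prod>p\<in>?D. y (T p))"
    by (rule sum.subset_diff) (auto intro: finite_bounded_tableaux finite_rows)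
  ultimately show ?thesis
    using sum_bounded_tableaux[OF f(1), of 0 M y] sum_bounded_tableaux[OF f(1), of 0 "Suc M" y] by simp
qed

text \<open>By \<open>sum_corner_tableaux\<close>, for \<open>f m < n\<close> this is the generating
  series of the tableaux with corner entry \<open>Suc M\<close>.\<close>

definition layer :: "nat \<Rightarrow> nat \<Rightarrow> nat \<Rightarrow> (nat \<Rightarrow> nat) \<Rightarrow> real fps" where
  "layer m n M f =
    strip_sum m n (map geom [1..<Suc (Suc M)]) f - strip_sum m n (map geom [1..<Suc M]) f"

text \<open>The sum over exponents is exchanged with that over the corner entry and, within one
  layer, with that over tableaux. There the corner factor from \<open>sum_exponents\<close> is the
  constant \<open>1 / Suc M\<close>.\<close>

lemma schur_zeta_sum_sums:
  assumes f: "inner_shape m n f" "f m < n" "m \<ge> 1"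
  shows "(\<lambda>M. if card (rows m n f) < w
      then 1 / real (Suc M) * fps_nth (layer m n M f) (w - card (rows m n f) - 1) else 0)
    sums schur_zeta_sum w (rows m n f)"
proof -
  let ?D = "rows m n f" and ?C = "\<lambda>M. {T \<in> bounded_tableaux 0 (Suc M) (rows m n f). T (m, n) = Suc M}"
  have "(\<lambda>M. \<Sum>k\<in>exponents w ?D. \<Sum>T\<in>?C M. \<Prod>p\<in>?D. 1 / real (T p) ^ k p)
      sums (\<Sum>k\<in>exponents w ?D. schur_zeta ?D k)"
    by (intro sums_sum corner_tableaux_sums[OF f])
  moreover have "(\<Sum>k\<in>exponents w ?D. \<Sum>T\<in>?C M. \<Prod>p\<in>?D. 1 / real (T p) ^ k p) =
     (if card ?D < w then 1 / real (Suc M) * fps_nth (layer m n M f) (w - card ?D - 1) else 0)" for M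
  proof -
    have "(\<Sum>k\<in>exponents w ?D. \<Sum>T\<in>?C M. \<Prod>p\<in>?D. 1 / real (T p) ^ k p) =
      (\<Sum>T\<in>?C M. \<Sum>k\<in>exponents w ?D. \<Prod>p\<in>?D. 1 / real (T p) ^ k p)"
      by (rule sum.swap)
    also have "\<dots> = (\<Sum>T\<in>?C M. if card ?D < w
        then 1 / real (Suc M) * fps_nth (\<Prod>p\<in>?D. geom (T p)) (w - card ?D - 1) else 0)"
      by (intro sum.cong refl) (simp add: sum_exponents[OF finite_rows corners_rows[OF f]])
    also have "\<dots> = (if card ?D < w
        then 1 / real (Suc M) * fps_nth (\<Sum>T\<in>?C M. \<Prod>p\<in>?D. geom (T p)) (w - card ?D - 1) else 0)"
      by (simp add: fps_sum_nth sum_distrib_left)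
    finally show ?thesis unfolding sum_corner_tableaux[OF f] layer_def .
  qed
  ultimately show ?thesis by (simp add: schur_zeta_sum_def exponents_def)
qed

lemma card_rows_lower:
  assumes "i \<in> {1..m}" "1 \<le> f i" "f i \<le> n"
  shows "card (rows m n (f(i := f i - 1))) = Suc (card (rows m n f))"
proof -
  have "rows m n (f(i := f i - 1)) = insert (i, f i) (rows m n f)"
    using assms by (auto simp: rows_def split: if_splits)
  moreover have "(i, f i) \<notin> rows m n f" by (simp add: mem_rows)
  ultimately show ?thesis by (simp add: finite_rows)
qed

lemma inner_shape_lower:
  assumes f: "inner_shape m n f" and i: "i \<in> {1..m}" "1 \<le> f i"
    and drop: "i < m \<Longrightarrow> f (Suc i) < f i"
  shows "inner_shape m n (f(i := f i - 1))"
proof -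
  have "f j \<le> f i - 1" if "i < j" "j \<le> m" for j
    using inner_shape_antimono[OF f, of "Suc i" j] drop i that by fastforce
  then show ?thesis
    using f i by (auto simp: inner_shape_def intro: diff_le_self le_trans)
qed

text \<open>The coefficients in \<open>deriv_strip_sum\<close> do not depend on the variables, so
  the formula passes to the difference. Rows whose lowering breaks monotonicity create an ascent and
  drop out.\<close>

lemma layer_identity:
  assumes f: "inner_shape m n f" "f 1 = n" "f m \<ge> 1" "f m < n" "m \<ge> 1"
  shows "fps_deriv (layer m n M f) =
    (\<Sum>i\<in>{i \<in> {1..m}. inner_shape m n (f(i := f i - 1))}.
       of_int (int i - int (f i) - (int m - int n)) * layer m n M (f(i := f i - 1)))"
proof -
  have pos: "1 \<le> f i" if "i \<in> {1..m}" for i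
    using inner_shape_antimono[OF f(1), of i m] that f(3) by auto
  have zero: "layer m n M (f(i := f i - 1)) = 0"
    if i: "i \<in> {1..m}" and not: "\<not> inner_shape m n (f(i := f i - 1))" for i
  proof -
    have im: "i < m" "\<not> f (Suc i) < f i" 
      using inner_shape_lower[OF f(1) i pos[OF i]] not by blast+
    have le: "(f(i := f i - 1)) j \<le> n" if "j \<in> {1..m}" for j
      using inner_shape_le[OF f(1), of j] that by auto
    have "strip_sum m n ys (f(i := f i - 1)) = 0" for ys :: "real fps list"
      by (rule strip_sum_ascent[of i]) (use i im le pos[OF i] in auto)
    then show ?thesis by (simp add: layer_def)
  qed
  have geom: "\<forall>y\<in>set (map geom xs). fps_deriv y = y ^ 2" for xs by (auto simp: fps_deriv_geom)
  have "fps_deriv (layer m n M f) =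
    (\<Sum>i=1..m. of_int (int i - int (f i) - (int m - int n)) * layer m n M (f(i := f i - 1)))"
    unfolding layer_def fps_deriv_sub deriv_strip_sum[OF f(1,2,3,5) geom]
    by (simp only: sum_subtractf[symmetric] right_diff_distrib)
  also have "\<dots> = (\<Sum>i\<in>{i \<in> {1..m}. inner_shape m n (f(i := f i - 1))}.
       of_int (int i - int (f i) - (int m - int n)) * layer m n M (f(i := f i - 1)))"
    using zero by (intro sum.mono_neutral_right) auto
  finally show ?thesis .
qed

text \<open>The two series over the corner entry agree term by term. A lowered shape has one box
  more, so its coefficient index is one less, which matches the index shift of a derivative.\<close>

lemma schur_zeta_sum_lower:
  assumes f: "inner_shape m n f" "f 1 = n" "f m \<ge> 1" "f m < n" "m \<ge> 1"
  shows "(\<Sum>i\<in>{i \<in> {1..m}. inner_shape m n (f(i := f i - 1))}.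
      ((real i - real (f i)) - (real m - real n)) * schur_zeta_sum w (rows m n (f(i := f i - 1))))
    = (real w - real (card (rows m n f)) - 1) * schur_zeta_sum w (rows m n f)"
proof -
  let ?I = "{i \<in> {1..m}. inner_shape m n (f(i := f i - 1))}"
  let ?f = "\<lambda>i. f(i := f i - 1)"
  let ?c = "\<lambda>i. (real i - real (f i)) - (real m - real n)"
  define d where "d = card (rows m n f)"
  define V where "V f M = (if card (rows m n f) < w
      then 1 / real (Suc M) * fps_nth (layer m n M f) (w - card (rows m n f) - 1) else 0)" for f M
  have card: "card (rows m n (?f i)) = Suc d" if "i \<in> ?I" for i
    unfolding d_def using that inner_shape_antimono[OF f(1), of i m] inner_shape_le[OF f(1), of i] f(3)
    by (intro card_rows_lower) auto
  have V: "(\<Sum>i\<in>?I. ?c i * V (?f i) M) = (real w - real d - 1) * V f M" for M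
  proof -
    \<comment> \<open>For \<open>w \<le> d\<close> every term is 0; for \<open>w = Suc d\<close> the
      left ones are 0 and so is the factor on the right. Otherwise \<open>e\<close> is the index for
      the lowered shapes, and differentiation supplies the factor
      \<open>e + 1 = w - d - 1\<close>.\<close>
    consider "w \<le> d" | "w = Suc d" | e where "w = Suc (Suc d) + e"
      by (metis le_iff_add not_less_eq_eq le_antisym)
    then show ?thesis
    proof cases
      case (3 e)
      have "(\<Sum>i\<in>?I. ?c i * V (?f i) M) = (\<Sum>i\<in>?I. ?c i * (1 / real (Suc M) * fps_nth (layer m n M (?f i)) e))"
        using card 3 by (intro sum.cong refl) (simp add: V_def)
      also have "\<dots> = 1 / real (Suc M) * fps_nth (\<Sum>i\<in>?I. of_int (int i - int (f i) - (int m - int n)) * layer m n M (?f i)) e"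
        unfolding fps_sum_nth sum_distrib_left
        by (intro sum.cong refl) (simp flip: fps_of_int)
      also have "\<dots> = 1 / real (Suc M) * fps_nth (fps_deriv (layer m n M f)) e"
        by (simp only: layer_identity[OF f])
      also have "\<dots> = (real w - real d - 1) * V f M"
        using 3 by (simp add: V_def flip: d_def)
      finally show ?thesis .
    qed (use card in \<open>simp_all add: V_def d_def[symmetric]\<close>)
  qed
  have "(\<lambda>M. \<Sum>i\<in>?I. ?c i * V (?f i) M) sums
      (\<Sum>i\<in>?I. ?c i * schur_zeta_sum w (rows m n (?f i)))"
    unfolding V_def using f(4,5) by (intro sums_sum sums_mult schur_zeta_sum_sums) auto
  moreover have "(\<lambda>M. (real w - real d - 1) * V f M) sums
      ((real w - real d - 1) * schur_zeta_sum w (rows m n f))"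
    unfolding V_def by (intro sums_mult schur_zeta_sum_sums f)
  ultimately show ?thesis unfolding V d_def by (rule sums_unique2)
qed

section \<open>From partitions as lists to inner shapes as functions\<close>

lemma diagram_replicate: "diagram (replicate m n) \<mu> = rows m n (part \<mu>)"
  by (auto simp: diagram_def rows_def part_def)

lemma part_lower_part:
  assumes "i \<in> {1..length \<mu>}"
  shows "part (lower_part \<mu> i) = (part \<mu>)(i := part \<mu> i - 1)"
  using assms by (auto simp: part_def lower_part_def fun_eq_iff nth_list_update)

lemma is_partition_iff_part:
  "is_partition \<mu> \<longleftrightarrow> (\<forall>i\<in>{1..length \<mu>}. \<forall>j\<in>{1..length \<mu>}. i \<le> j \<longrightarrow> part \<mu> j \<le> part \<mu> i)"
proof
  assume "is_partition \<mu>"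
  then have "\<mu> ! (j - 1) \<le> \<mu> ! (i - 1)" if "1 \<le> i" "i < j" "j \<le> length \<mu>" for i j
    using that by (simp add: is_partition_def sorted_wrt_iff_nth_less)
  then show "\<forall>i\<in>{1..length \<mu>}. \<forall>j\<in>{1..length \<mu>}. i \<le> j \<longrightarrow> part \<mu> j \<le> part \<mu> i"
    by (auto simp: part_def le_less)
next
  assume R: "\<forall>i\<in>{1..length \<mu>}. \<forall>j\<in>{1..length \<mu>}. i \<le> j \<longrightarrow> part \<mu> j \<le> part \<mu> i"
  show "is_partition \<mu>"
    unfolding is_partition_def sorted_wrt_iff_nth_less
  proof (intro allI impI)
    fix i j assume "i < j" "j < length \<mu>"
    then show "\<mu> ! j \<le> \<mu> ! i"
      using R[rule_format, of "Suc i" "Suc j"] by (simp add: part_def)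
  qed
qed

theorem theorem4p8:
  fixes m n w :: nat and \<mu> :: "nat list"
  assumes "m \<ge> 1"
    and "length \<mu> = m"
    and "skew_shape (replicate m n) \<mu>"
    and "part \<mu> 1 = n"
    and "part \<mu> m > 0"
    and "card (corners (diagram (replicate m n) \<mu>)) = 1"
    and "w \<ge> 1"
  shows "(\<Sum>i\<in>{i \<in> {1..m}. is_partition (lower_part \<mu> i)}.
            ((real i - real (part \<mu> i)) - (real m - real n)) *
            schur_zeta_sum w (diagram (replicate m n) (lower_part \<mu> i)))
         = (real w - real (card (diagram (replicate m n) \<mu>)) - 1) *
           schur_zeta_sum w (diagram (replicate m n) \<mu>)"
proof -
  let ?f = "part \<mu>"
  have "part (replicate m n) i = n" if "i \<in> {1..m}" for i
    using that by (auto simp: part_def)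
  then have le: "?f i \<le> n" if "i \<in> {1..m}" for i
    using assms(3) that by (fastforce simp: skew_shape_def)
  then have shape: "inner_shape m n ?f"
    using assms(2,3) by (simp add: inner_shape_def skew_shape_def is_partition_iff_part)
  \<comment> \<open>A corner makes the diagram nonempty; then row \<open>m\<close> is nonempty too,
    because the parts of \<open>\<mu>\<close> are non-increasing.\<close>
  have "corners (rows m n ?f) \<noteq> {}"
    using assms(6) by (auto simp: diagram_replicate)
  then obtain i j where "(i, j) \<in> rows m n ?f" by (auto simp: corners_def)
  then have "?f m < n"
    using inner_shape_antimono[OF shape, of i m] by (auto simp: mem_rows)
  have "is_partition (lower_part \<mu> i) \<longleftrightarrow> inner_shape m n (?f(i := ?f i - 1))" if "i \<in> {1..m}" for i
  proof -
    have "length (lower_part \<mu> i) = m" using assms(2) by (simp add: lower_part_def)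
    moreover have "(?f(i := ?f i - 1)) j \<le> n" if "j \<in> {1..m}" for j
      using le[OF that] by auto
    ultimately show ?thesis
      using that assms(2) unfolding is_partition_iff_part inner_shape_def
      by (simp only: part_lower_part) blast
  qed
  then have "{i \<in> {1..m}. is_partition (lower_part \<mu> i)} = {i \<in> {1..m}. inner_shape m n (?f(i := ?f i - 1))}"
    by blast
  moreover have "diagram (replicate m n) (lower_part \<mu> i) = rows m n (?f(i := ?f i - 1))"
    if "i \<in> {1..m}" for i
    using that assms(2) by (simp only: diagram_replicate part_lower_part)
  ultimately have "(\<Sum>i\<in>{i \<in> {1..m}. is_partition (lower_part \<mu> i)}.
        ((real i - real (?f i)) - (real m - real n)) *
        schur_zeta_sum w (diagram (replicate m n) (lower_part \<mu> i))) =
      (\<Sum>i\<in>{i \<in> {1..m}. inner_shape m n (?f(i := ?f i - 1))}.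
        ((real i - real (?f i)) - (real m - real n)) *
        schur_zeta_sum w (rows m n (?f(i := ?f i - 1))))"
    by (intro sum.cong) simp_all
  also have "\<dots> = (real w - real (card (rows m n ?f)) - 1) * schur_zeta_sum w (rows m n ?f)"
    using assms(5) by (intro schur_zeta_sum_lower[OF shape assms(4) _ \<open>?f m < n\<close> assms(1)]) simp
  finally show ?thesis by (simp only: diagram_replicate)
qed

end
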